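(* For any $q\in \mathbb{N}$ we have $$c_{2q} = \frac{4q-1}{2q^2} \sum_{j=1}^q 4^j\, j \binom{2q}{2j} c_{q-j}, \qquad c_{2q+1} = \frac{2(4q+1)}{(2q+1)^2} \sum_{j=0}^q 4^j (2j+1) \binom{2q+1}{2j+1} c_{q-j}.$$
   Context: $\mathbb{N}=\{1,2,\dots\}$; $c_m=\binom{2m}{m}$ ($m\ge 0$) denotes the $m$-th central binomial coefficient. The identities are in $\mathbb{Q}$. *)

theory Defs
  imports Complex_Main
begin

definition central_binom :: "nat \<Rightarrow> nat" where
  "central_binom m = (2 * m) choose m"

end

theory Submission
  imports Defs "HOL-Computational_Algebra.Polynomial"
begin

text \<open>
  Both sums range over the \<open>i = q - j\<close> with \<open>2 * i < n\<close>, where \<open>n\<close> is \<open>2 * q\<close> or \<open>2 * q + 1\<close>.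
  Absorbing the factor \<open>n - 2 * i\<close> into the binomial coefficient turns them into \<open>n\<close> times
  the coefficient of \<open>x ^ (n - 1)\<close> in \<open>((1 + x\<^sup>2) + 2 * x) ^ (n - 1) = (1 + x) ^ (2 * (n - 1))\<close>,
  a central binomial coefficient. The recurrence of the central binomial coefficients
  then gives both identities.
\<close>

text \<open>Both sides are compared with \<open>(2 * n + 1) choose n\<close>: absorption links it to
  \<open>central_binom (Suc n)\<close> on one side and to \<open>central_binom n\<close> on the
  other.\<close>

lemma central_binom_Suc:
  "Suc n * central_binom (Suc n) = 2 * (2 * n + 1) * central_binom n"
proof -
  have "Suc n * central_binom (Suc n) = (2 * n + 2) * ((2 * n + 1) choose n)"
    using Suc_times_binomial_eq[of "2 * n + 1" n]
    by (simp add: central_binom_def mult.commute)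
  moreover have "(n + 1) * ((2 * n + 1) choose n) = (2 * n + 1) * central_binom n"
    using binomial_absorb_comp[of "2 * n + 1" n] by (simp add: central_binom_def)
  ultimately show ?thesis
    by (metis (no_types, lifting) add_mult_distrib2 mult.assoc mult_2 one_add_one)
qed

text \<open>Needed for \<open>d = 2\<close>, to expand powers of \<open>1 + x^2\<close>, and for
  \<open>d = 1\<close>, to read off the middle coefficient of
  \<open>(1 + x) ^ (2 * m)\<close>.\<close>

lemma coeff_one_plus_monom_power:
  fixes b :: "'a::comm_semiring_1"
  shows "coeff ((1 + monom b d) ^ n) k = (\<Sum>i\<le>n. if d * i = k then of_nat (n choose i) * b ^ i else 0)"
proof -
  have "(1 + monom b d) ^ n = (monom b d + 1) ^ n"
    by (simp add: add.commute)
  also have "\<dots> = (\<Sum>i\<le>n. monom (of_nat (n choose i) * b ^ i) (d * i))"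
    unfolding binomial_ring
    by (simp add: monom_power of_nat_monom mult_monom mult.commute)
  finally show ?thesis
    by (simp add: coeff_sum)
qed

lemma sum_power2_binomial_central_binom:
  "(\<Sum>i\<le>m div 2. 2 ^ (m - 2 * i) * (m choose (2 * i)) * central_binom i) = central_binom m"
proof -
  define p :: "nat poly" where "p = 1 + monom 1 2"
  \<comment> \<open>Since \<open>p\<close> is a polynomial in \<open>x^2\<close>, only an even
    \<open>k = 2 * i\<close> gives a nonzero coefficient, namely
    \<open>(2 * i) choose i\<close>.\<close>
  have central: "coeff (p ^ k) k = (if even k then central_binom (k div 2) else 0)" for k
  proof -
    have "coeff (p ^ k) k = (\<Sum>i\<le>k. if 2 * i = k then k choose i else 0)"
      unfolding p_def coeff_one_plus_monom_power by (intro sum.cong) auto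
    also have "\<dots> = (\<Sum>i | i \<le> k \<and> 2 * i = k. k choose i)"
      by (intro sum.mono_neutral_cong_right) auto
    also have "{i. i \<le> k \<and> 2 * i = k} = (if even k then {k div 2} else {})"
      by auto
    finally show ?thesis
      by (auto simp: central_binom_def)
  qed
  \<comment> \<open>The factor \<open>(2 * x) ^ (m - k)\<close> shifts degrees by
    \<open>m - k\<close>, so \<open>p ^ k\<close> has to supply exactly
    \<open>x ^ k\<close>.\<close>
  have coeff_term: "coeff (of_nat (m choose k) * p ^ k * monom 2 1 ^ (m - k)) m
      = (m choose k) * 2 ^ (m - k) * coeff (p ^ k) k" if "k \<le> m" for k
    using that
    by (simp add: monom_power of_nat_poly coeff_monom_mult mult.commute[of _ "monom _ _"])
  have "central_binom m = coeff ((1 + monom 1 1) ^ (2 * m)) m"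
    by (simp add: coeff_one_plus_monom_power central_binom_def)
  also have "(1 + monom 1 1 :: nat poly) ^ (2 * m) = (p + monom 2 1) ^ m"
  proof -
    have "monom 2 1 = (monom 1 1 + monom 1 1 :: nat poly)"
      unfolding add_monom by simp
    then have "(1 + monom 1 1 :: nat poly)\<^sup>2 = p + monom 2 1"
      by (simp add: p_def power2_eq_square algebra_simps mult_monom numeral_2_eq_2)
    then show ?thesis
      by (simp only: power_mult)
  qed
  also have "coeff \<dots> m = (\<Sum>k\<le>m. (m choose k) * 2 ^ (m - k) * coeff (p ^ k) k)"
    unfolding binomial_ring coeff_sum by (intro sum.cong refl coeff_term) auto
  \<comment> \<open>Odd \<open>k\<close> drop out by \<open>central\<close>; the even
    \<open>k \<le> m\<close> are the doubles of the \<open>i \<le> m div 2\<close>.\<close>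
  also have "\<dots> = (\<Sum>k\<in>(*) 2 ` {..m div 2}. (m choose k) * 2 ^ (m - k) * coeff (p ^ k) k)"
    by (intro sum.mono_neutral_right) (auto simp: central elim!: evenE)
  also have "\<dots> = (\<Sum>i\<le>m div 2. 2 ^ (m - 2 * i) * (m choose (2 * i)) * central_binom i)"
    by (subst sum.reindex) (auto simp: inj_on_def central mult.commute)
  finally show ?thesis ..
qed

text \<open>Absorption, \<open>(Suc m - k) * (Suc m choose k) = Suc m * (m choose k)\<close> at
  \<open>k = 2 * i\<close>, pulls the constant \<open>Suc m\<close> out of the previous sum.\<close>

lemma weighted_sum_power2_binomial_central_binom:
  "(\<Sum>i\<le>m div 2. 2 ^ (m - 2 * i) * (Suc m - 2 * i) * (Suc m choose (2 * i)) * central_binom i)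
     = Suc m * central_binom m"
proof -
  have "(Suc m - k) * (Suc m choose k) = Suc m * (m choose k)" for k
    using binomial_absorb_comp[of "Suc m" k] by simp
  then have "2 ^ (m - 2 * i) * (Suc m - 2 * i) * (Suc m choose (2 * i)) * central_binom i
      = Suc m * (2 ^ (m - 2 * i) * (m choose (2 * i)) * central_binom i)" for i
    by (metis mult.assoc mult.left_commute)
  then show ?thesis
    by (simp only: sum_power2_binomial_central_binom flip: sum_distrib_left)
qed

text \<open>The weighted sum at \<open>m = 2 * q - 1\<close> with \<open>i = q - j\<close>: the
  power and the weight combine as \<open>2 ^ (2 * j - 1) * (2 * j) = 4 ^ j * j\<close>. Here
  \<open>m div 2 = q - 1\<close>, which matches the start at \<open>j = 1\<close>.\<close>

lemma sum_even_binomial_central_binom: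
  assumes "q \<ge> 1"
  shows "(\<Sum>j=1..q. 4 ^ j * j * ((2 * q) choose (2 * j)) * central_binom (q - j))
           = 2 * q * central_binom (2 * q - 1)"
proof -
  have "(\<Sum>j=1..q. 4 ^ j * j * ((2 * q) choose (2 * j)) * central_binom (q - j))
      = (\<Sum>i\<le>(2 * q - 1) div 2. 2 ^ (2 * q - 1 - 2 * i) * (Suc (2 * q - 1) - 2 * i)
            * (Suc (2 * q - 1) choose (2 * i)) * central_binom i)"
  proof (rule sum.reindex_bij_witness[of _ "\<lambda>i. q - i" "\<lambda>j. q - j"])
    fix j assume j: "j \<in> {1..q}"
    \<comment> \<open>With \<open>j = Suc k\<close> the exponent \<open>2 * j - 1\<close> becomes
      \<open>2 * k + 1\<close>, free of truncated subtraction.\<close>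
    then obtain k where "j = Suc k" "k < q"
      by (cases j) auto
    moreover have "(2 * q) choose (2 * q - 2 * j) = (2 * q) choose (2 * j)"
      using j binomial_symmetric[of "2 * j" "2 * q"] by simp
    ultimately show "2 ^ (2 * q - 1 - 2 * (q - j)) * (Suc (2 * q - 1) - 2 * (q - j))
        * (Suc (2 * q - 1) choose (2 * (q - j))) * central_binom (q - j)
      = 4 ^ j * j * ((2 * q) choose (2 * j)) * central_binom (q - j)"
      by (simp add: diff_mult_distrib2 power_mult)
  qed (use assms in auto)
  also have "\<dots> = 2 * q * central_binom (2 * q - 1)"
    unfolding weighted_sum_power2_binomial_central_binom using assms by simp
  finally show ?thesis .
qed

text \<open>The weighted sum at \<open>m = 2 * q\<close> with \<open>i = q - j\<close>: the power is
  \<open>2 ^ (2 * j) = 4 ^ j\<close> and the weight is \<open>2 * j + 1\<close>. Now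
  \<open>j = 0\<close> does occur.\<close>

lemma sum_odd_binomial_central_binom:
  "(\<Sum>j=0..q. 4 ^ j * (2 * j + 1) * ((2 * q + 1) choose (2 * j + 1)) * central_binom (q - j))
     = (2 * q + 1) * central_binom (2 * q)"
proof -
  have "(\<Sum>j=0..q. 4 ^ j * (2 * j + 1) * ((2 * q + 1) choose (2 * j + 1)) * central_binom (q - j))
      = (\<Sum>i\<le>2 * q div 2. 2 ^ (2 * q - 2 * i) * (Suc (2 * q) - 2 * i)
            * (Suc (2 * q) choose (2 * i)) * central_binom i)"
  proof (rule sum.reindex_bij_witness[of _ "\<lambda>i. q - i" "\<lambda>j. q - j"])
    fix j assume j: "j \<in> {0..q}"
    then have "Suc (2 * q) choose (2 * q - 2 * j) = Suc (2 * q) choose Suc (2 * j)"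
      using binomial_symmetric[of "Suc (2 * j)" "Suc (2 * q)"] by simp
    moreover have "Suc (2 * q) - (2 * q - 2 * j) = Suc (2 * j)"
      using j by auto
    ultimately show "2 ^ (2 * q - 2 * (q - j)) * (Suc (2 * q) - 2 * (q - j))
        * (Suc (2 * q) choose (2 * (q - j))) * central_binom (q - j)
      = 4 ^ j * (2 * j + 1) * ((2 * q + 1) choose (2 * j + 1)) * central_binom (q - j)"
      using j by (simp add: diff_mult_distrib2 power_mult)
  qed auto
  also have "\<dots> = (2 * q + 1) * central_binom (2 * q)"
    unfolding weighted_sum_power2_binomial_central_binom by simp
  finally show ?thesis .
qed

theorem proposition5p1:
  fixes q :: nat
  assumes "q \<ge> 1"
  shows "(of_nat (central_binom (2 * q)) :: rat) =
           (4 * of_nat q - 1) / (2 * of_nat q ^ 2) *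
           (\<Sum>j=1..q. 4 ^ j * of_nat j * of_nat ((2 * q) choose (2 * j)) *
                      of_nat (central_binom (q - j))) \<and>
         (of_nat (central_binom (2 * q + 1)) :: rat) =
           2 * (4 * of_nat q + 1) / (2 * of_nat q + 1) ^ 2 *
           (\<Sum>j=0..q. 4 ^ j * (2 * of_nat j + 1) *
                      of_nat ((2 * q + 1) choose (2 * j + 1)) *
                      of_nat (central_binom (q - j)))"
proof
  have q: "(of_nat q :: rat) \<noteq> 0"
    using assms by simp
  have sum_even: "(\<Sum>j=1..q. 4 ^ j * of_nat j * of_nat ((2 * q) choose (2 * j)) *
      of_nat (central_binom (q - j)) :: rat) = 2 * of_nat q * of_nat (central_binom (2 * q - 1))"
    using arg_cong[OF sum_even_binomial_central_binom[OF assms], of "of_nat :: nat \<Rightarrow> rat"]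
    by simp
  obtain p where p: "q = Suc p"
    using assms by (cases q) auto
  \<comment> \<open>The factor \<open>4 * q - 1\<close> is \<open>2 * (2 * q - 1) + 1\<close> from
    the recurrence; \<open>q = Suc p\<close> resolves the natural subtraction under the
    cast.\<close>
  have "2 * of_nat q * of_nat (central_binom (2 * q))
      = (2 * (4 * of_nat q - 1) * of_nat (central_binom (2 * q - 1)) :: rat)"
    using arg_cong[OF central_binom_Suc[of "2 * q - 1"], of "of_nat :: nat \<Rightarrow> rat"]
    by (simp add: p algebra_simps)
  then have "(of_nat (central_binom (2 * q)) :: rat)
      = (4 * of_nat q - 1) * of_nat (central_binom (2 * q - 1)) / of_nat q"
    using q by (simp add: nonzero_eq_divide_eq algebra_simps)
  then show "(of_nat (central_binom (2 * q)) :: rat) =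
      (4 * of_nat q - 1) / (2 * of_nat q ^ 2) *
      (\<Sum>j=1..q. 4 ^ j * of_nat j * of_nat ((2 * q) choose (2 * j)) *
                 of_nat (central_binom (q - j)))"
    unfolding sum_even using q by (simp add: power2_eq_square)
next
  \<comment> \<open>The denominator is the cast of a positive natural number.\<close>
  have pos: "(2 * of_nat q + 1 :: rat) \<noteq> 0"
    by (metis of_nat_1 of_nat_add of_nat_eq_0_iff of_nat_mult of_nat_numeral add_is_0 one_neq_zero)
  have sum_odd: "(\<Sum>j=0..q. 4 ^ j * (2 * of_nat j + 1) * of_nat ((2 * q + 1) choose (2 * j + 1)) *
      of_nat (central_binom (q - j)) :: rat) = (2 * of_nat q + 1) * of_nat (central_binom (2 * q))"
    using arg_cong[OF sum_odd_binomial_central_binom[of q], of "of_nat :: nat \<Rightarrow> rat"]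
    by (simp only: of_nat_sum of_nat_mult of_nat_power of_nat_add of_nat_1 of_nat_numeral)
  have "(2 * of_nat q + 1) * of_nat (central_binom (2 * q + 1))
      = (2 * (4 * of_nat q + 1) * of_nat (central_binom (2 * q)) :: rat)"
    using arg_cong[OF central_binom_Suc[of "2 * q"], of "of_nat :: nat \<Rightarrow> rat"]
    by (simp add: algebra_simps)
  then have "(of_nat (central_binom (2 * q + 1)) :: rat)
      = 2 * (4 * of_nat q + 1) * of_nat (central_binom (2 * q)) / (2 * of_nat q + 1)"
    using pos by (metis nonzero_mult_div_cancel_left)
  then show "(of_nat (central_binom (2 * q + 1)) :: rat) =
      2 * (4 * of_nat q + 1) / (2 * of_nat q + 1) ^ 2 *
      (\<Sum>j=0..q. 4 ^ j * (2 * of_nat j + 1) * of_nat ((2 * q + 1) choose (2 * j + 1)) *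
                 of_nat (central_binom (q - j)))"
    unfolding sum_odd using pos by (simp add: power2_eq_square)
qed

end
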